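(* Let $\mathcal{R}$ be a unital ring, let $n\geq 2$, let $M_n(\mathcal{R})$ be the ring of all $n\times n$ matrices over $\mathcal{R}$ with identity matrix $\mathbf{1}$, and let $\mathcal{M}$ be a $2$-torsion free unital $M_n(\mathcal{R})$-bimodule. Let $D:M_n(\mathcal{R})\rightarrow\mathcal{M}$ be an additive map such that for all $\mathbf{a},\mathbf{b}\in M_n(\mathcal{R})$, $$\mathbf{a}\mathbf{b}=\mathbf{b}\mathbf{a}=0\ \Longrightarrow\ D(\mathbf{a})\mathbf{b}+\mathbf{a}D(\mathbf{b})+D(\mathbf{b})\mathbf{a}+\mathbf{b}D(\mathbf{a})=0.$$ Then there exists a derivation $\delta:M_n(\mathcal{R})\rightarrow\mathcal{M}$ such that $D(\mathbf{a})=\delta(\mathbf{a})+\mathbf{a}D(\mathbf{1})$ for each $\mathbf{a}\in M_n(\mathcal{R})$, and $D(\mathbf{1})\in Z(\mathcal{M})$.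
   Context: All rings are associative (not necessarily commutative). An $\mathcal{A}$-bimodule $\mathcal{M}$ over a unital ring $\mathcal{A}$ is unital if $1m=m=m1$ for all $m\in\mathcal{M}$, and is $2$-torsion free if $2m=0$ implies $m=0$ for $m\in\mathcal{M}$. An additive map $\delta:\mathcal{A}\rightarrow\mathcal{M}$ is a derivation if $\delta(ab)=\delta(a)b+a\delta(b)$ for all $a,b\in\mathcal{A}$. The centre of $\mathcal{M}$ is $Z(\mathcal{M})=\{m\in\mathcal{M}: am=ma \text{ for all } a\in\mathcal{A}\}$. *)

theory Defs
  imports "Jordan_Normal_Form.Matrix"
begin

text \<open>
  The sort \<open>{ring,monoid_mult}\<close> is that of associative unital, not necessarily commutative
  rings. Unlike \<open>ring_1\<close> it does not demand \<open>0 \<noteq> 1\<close>, which is why the library's \<open>ring_mat\<close>,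
  restricted to \<open>semiring_1\<close>, is not used here.
\<close>

definition mat_ring :: "nat \<Rightarrow> 'r :: {ring, monoid_mult} mat ring" where
  "mat_ring n =
    \<lparr>carrier = carrier_mat n n, mult = (*), one = 1\<^sub>m n, zero = 0\<^sub>m n n, add = (+)\<rparr>"

lemma mat_ring_simps [simp]:
  "carrier (mat_ring n) = carrier_mat n n"
  "mult (mat_ring n) = (*)"
  "one (mat_ring n) = 1\<^sub>m n"
  "zero (mat_ring n) = 0\<^sub>m n n"
  "add (mat_ring n) = (+)"
  by (simp_all add: mat_ring_def)

lemma left_mult_one_mat_ring:
  fixes A :: "'r :: {ring, monoid_mult} mat"
  assumes A: "A \<in> carrier_mat n m"
  shows "1\<^sub>m n * A = A"
proof (rule eq_matI)
  fix i j assume ij: "i < dim_row A" "j < dim_col A"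
  have "(1\<^sub>m n * A) $$ (i, j) = (\<Sum>k\<in>{0..<n}. (if i = k then 1 else 0) * A $$ (k, j))"
    using A ij by (auto simp: scalar_prod_def intro!: sum.cong)
  also have "\<dots> = (\<Sum>k\<in>{0..<n}. if i = k then A $$ (k, j) else 0)"
    by (rule sum.cong) auto
  finally show "(1\<^sub>m n * A) $$ (i, j) = A $$ (i, j)"
    using A ij by simp
qed (use A in auto)

lemma right_mult_one_mat_ring:
  fixes A :: "'r :: {ring, monoid_mult} mat"
  assumes A: "A \<in> carrier_mat m n"
  shows "A * 1\<^sub>m n = A"
proof (rule eq_matI)
  fix i j assume ij: "i < dim_row A" "j < dim_col A"
  have "(A * 1\<^sub>m n) $$ (i, j) = (\<Sum>k\<in>{0..<n}. A $$ (i, k) * (if k = j then 1 else 0))"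
    using A ij by (auto simp: scalar_prod_def intro!: sum.cong)
  also have "\<dots> = (\<Sum>k\<in>{0..<n}. if k = j then A $$ (i, k) else 0)"
    by (rule sum.cong) auto
  finally show "(A * 1\<^sub>m n) $$ (i, j) = A $$ (i, j)"
    using A ij by simp
qed (use A in auto)

lemma ring_mat_ring: "ring (mat_ring n :: 'r :: {ring, monoid_mult} mat ring)"
proof (rule ringI)
  show "abelian_group (mat_ring n :: 'r mat ring)"
  proof (rule abelian_groupI)
    fix A :: "'r mat" assume A: "A \<in> carrier (mat_ring n)"
    show "\<exists>B\<in>carrier (mat_ring n). B \<oplus>\<^bsub>mat_ring n\<^esub> A = \<zero>\<^bsub>mat_ring n\<^esub>"
      using A by (intro bexI[of _ "- A"]) auto
  qed (auto simp: assoc_add_mat comm_add_mat)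
  show "Group.monoid (mat_ring n :: 'r mat ring)"
    by (rule monoidI) (auto simp: left_mult_one_mat_ring right_mult_one_mat_ring)
qed (auto simp: add_mult_distrib_mat mult_add_distrib_mat)

text \<open>
  The bimodule is carried by a whole type; the actions and the maps below are constrained only
  on the carrier of the ring.
\<close>

locale unital_bimodule = ring A
  for A :: "('a, 'b) ring_scheme" (structure) +
  fixes lact :: "'a \<Rightarrow> 'm :: ab_group_add \<Rightarrow> 'm" (infixr \<open>\<triangleright>\<close> 75)
    and ract :: "'m \<Rightarrow> 'a \<Rightarrow> 'm" (infixl \<open>\<triangleleft>\<close> 75)
  assumes lact_add_right: "a \<in> carrier A \<Longrightarrow> a \<triangleright> (x + y) = a \<triangleright> x + a \<triangleright> y"
    and lact_add_left:
      "\<lbrakk>a \<in> carrier A; b \<in> carrier A\<rbrakk> \<Longrightarrow> (a \<oplus> b) \<triangleright> x = a \<triangleright> x + b \<triangleright> x"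
    and lact_mult: "\<lbrakk>a \<in> carrier A; b \<in> carrier A\<rbrakk> \<Longrightarrow> (a \<otimes> b) \<triangleright> x = a \<triangleright> (b \<triangleright> x)"
    and lact_one: "\<one> \<triangleright> x = x"
    and ract_add_left: "a \<in> carrier A \<Longrightarrow> (x + y) \<triangleleft> a = x \<triangleleft> a + y \<triangleleft> a"
    and ract_add_right:
      "\<lbrakk>a \<in> carrier A; b \<in> carrier A\<rbrakk> \<Longrightarrow> x \<triangleleft> (a \<oplus> b) = x \<triangleleft> a + x \<triangleleft> b"
    and ract_mult: "\<lbrakk>a \<in> carrier A; b \<in> carrier A\<rbrakk> \<Longrightarrow> x \<triangleleft> (a \<otimes> b) = (x \<triangleleft> a) \<triangleleft> b"
    and ract_one: "x \<triangleleft> \<one> = x"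
    and lact_ract: "\<lbrakk>a \<in> carrier A; b \<in> carrier A\<rbrakk> \<Longrightarrow> (a \<triangleright> x) \<triangleleft> b = a \<triangleright> (x \<triangleleft> b)"

definition two_torsion_free :: "'m :: ab_group_add itself \<Rightarrow> bool" where
  "two_torsion_free _ \<longleftrightarrow> (\<forall>m :: 'm. m + m = 0 \<longrightarrow> m = 0)"

definition additive_map :: "('a, 'b) ring_scheme \<Rightarrow> ('a \<Rightarrow> 'm :: ab_group_add) \<Rightarrow> bool" where
  "additive_map A f \<longleftrightarrow>
    (\<forall>a\<in>carrier A. \<forall>b\<in>carrier A. f (a \<oplus>\<^bsub>A\<^esub> b) = f a + f b)"

definition derivation ::
  "('a, 'b) ring_scheme \<Rightarrow> ('a \<Rightarrow> 'm \<Rightarrow> 'm) \<Rightarrow> ('m \<Rightarrow> 'a \<Rightarrow> 'm) \<Rightarrow>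
    ('a \<Rightarrow> 'm :: ab_group_add) \<Rightarrow> bool" where
  "derivation A lact ract \<delta> \<longleftrightarrow> additive_map A \<delta> \<and>
    (\<forall>a\<in>carrier A. \<forall>b\<in>carrier A. \<delta> (a \<otimes>\<^bsub>A\<^esub> b) = ract (\<delta> a) b + lact a (\<delta> b))"

definition bimodule_centre ::
  "('a, 'b) ring_scheme \<Rightarrow> ('a \<Rightarrow> 'm \<Rightarrow> 'm) \<Rightarrow> ('m \<Rightarrow> 'a \<Rightarrow> 'm) \<Rightarrow> 'm set" where
  "bimodule_centre A lact ract = {m. \<forall>a\<in>carrier A. lact a m = ract m a}"

end

theory Submission
  imports Defs
begin

text \<open>
  Write \<open>x\<^sub>i\<^sub>j\<close> for the matrix whose only nonzero entry is \<open>x\<close>, at position \<open>(i, j)\<close>, and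
  \<open>e\<^sub>i\<close> for the diagonal idempotent \<open>1\<^sub>i\<^sub>i\<close>. The theorem holds because matrix rings of size at least
  two have plenty of idempotents and of pairs \<open>a b = b a = 0\<close>, and every product
  \<open>x\<^sub>i\<^sub>j y\<^sub>j\<^sub>k\<close> can be read off from such a pair.

  An idempotent \<open>g\<close> annihilates its complement \<open>1 - g\<close> on both sides; evaluating the hypothesis
  there and cutting by \<open>g\<close> and \<open>1 - g\<close> shows that \<open>g\<close> commutes with \<open>D 1\<close>. The matrices \<open>x\<^sub>i\<^sub>j\<close>
  with \<open>i \<noteq> j\<close> are differences of idempotents, and \<open>x\<^sub>i\<^sub>i = x\<^sub>i\<^sub>k 1\<^sub>k\<^sub>i\<close>, so \<open>D 1\<close> is central
  (\<open>D_one_commutes\<close>). Then \<open>D a - a D 1\<close> inherits the hypothesis and vanishes at \<open>1\<close>; it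
  remains to see that such a map is a derivation.

  Subtracting a derivation does not affect the hypothesis either. The inner derivation of
  \<open>\<Sum>\<^sub>i D(e\<^sub>i) e\<^sub>i\<close> agrees with \<open>D\<close> on all \<open>e\<^sub>i\<close> (\<open>inner_on_diagonal\<close>), so \<open>D e\<^sub>i = 0\<close> may be
  assumed. Now \<open>D\<close> respects the Peirce decomposition: \<open>D(x\<^sub>i\<^sub>j)\<close> lies in \<open>e\<^sub>i M e\<^sub>j\<close>
  (\<open>D_unit_peirce\<close>). The delicate point is that the component in \<open>e\<^sub>j M e\<^sub>i\<close>, which a transposition-like
  map would produce, is zero (\<open>lower_corner_zero\<close>). With this grading both sides of the product
  rule vanish for \<open>x\<^sub>i\<^sub>j y\<^sub>k\<^sub>l\<close> with \<open>j \<noteq> k\<close>, and for \<open>x\<^sub>i\<^sub>j y\<^sub>j\<^sub>k\<close> a suitable zero product gives the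
  rule, except for \<open>i = j = k\<close>, where it follows by multiplying with an off-diagonal matrix unit.
\<close>

section \<open>Matrix units\<close>

definition unit_mat :: "nat \<Rightarrow> nat \<Rightarrow> nat \<Rightarrow> 'r :: {ring, monoid_mult} \<Rightarrow> 'r mat" where
  "unit_mat n i j x = mat n n (\<lambda>(k, l). if k = i \<and> l = j then x else 0)"

lemma unit_mat_closed [simp]: "unit_mat n i j x \<in> carrier_mat n n"
  by (simp add: unit_mat_def)

lemma unit_mat_dim [simp]: "dim_row (unit_mat n i j x) = n" "dim_col (unit_mat n i j x) = n"
  by (simp_all add: unit_mat_def)

lemma unit_mat_add: "unit_mat n i j (x + y) = unit_mat n i j x + unit_mat n i j y"
  by (rule eq_matI) (auto simp: unit_mat_def)

lemma unit_mat_zero [simp]: "unit_mat n i j 0 = 0\<^sub>m n n"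
  by (rule eq_matI) (auto simp: unit_mat_def)

lemma unit_mat_mult:
  assumes "j < n" "k < n"
  shows "unit_mat n i j x * unit_mat n k l y = (if j = k then unit_mat n i l (x * y) else 0\<^sub>m n n)"
proof (rule eq_matI, goal_cases)
  case (1 p q)
  then have pq: "p < n" "q < n" by (auto split: if_splits)
  have "(unit_mat n i j x * unit_mat n k l y) $$ (p, q) =
      (\<Sum>r\<in>{0..<n}. unit_mat n i j x $$ (p, r) * unit_mat n k l y $$ (r, q))"
    using pq by (simp add: scalar_prod_def)
  also have "\<dots> = (\<Sum>r\<in>{0..<n}. if r = j then (if p = i \<and> j = k \<and> q = l then x * y else 0) else 0)"
    by (rule sum.cong) (use pq in \<open>auto simp: unit_mat_def\<close>)
  also have "\<dots> = (if p = i \<and> j = k \<and> q = l then x * y else 0)"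
    using assms by simp
  finally show ?case using pq by (auto simp: unit_mat_def)
qed auto

lemma unit_mat_mult_same [simp]:
  "j < n \<Longrightarrow> unit_mat n i j x * unit_mat n j l y = unit_mat n i l (x * y)"
  by (simp add: unit_mat_mult)

lemma unit_mat_mult_diff [simp]:
  "\<lbrakk>j < n; k < n; j \<noteq> k\<rbrakk> \<Longrightarrow> unit_mat n i j x * unit_mat n k l y = 0\<^sub>m n n"
  by (simp add: unit_mat_mult)

lemma square_mat_distrib:
  fixes A B C :: "'r :: ring mat"
  assumes "A \<in> carrier_mat n n" "B \<in> carrier_mat n n" "C \<in> carrier_mat n n"
  shows "(A + B) * C = A * C + B * C" "A * (B + C) = A * B + A * C"
    and "(A - B) * C = A * C - B * C" "A * (B - C) = A * B - A * C"
  using assms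
  by (simp_all add: add_mult_distrib_mat mult_add_distrib_mat minus_mult_distrib_mat mult_minus_distrib_mat)

text \<open>
  Additive statements about matrices need to be checked only on matrix units, without ever
  writing a matrix as a sum over its entries.
\<close>

lemma unit_mat_induct [consumes 1, case_names zero unit add]:
  fixes A :: "'r :: {ring, monoid_mult} mat"
  assumes A: "A \<in> carrier_mat n n"
    and zero: "P (0\<^sub>m n n)"
    and unit: "\<And>i j x. \<lbrakk>i < n; j < n\<rbrakk> \<Longrightarrow> P (unit_mat n i j x)"
    and add: "\<And>B C. \<lbrakk>B \<in> carrier_mat n n; C \<in> carrier_mat n n; P B; P C\<rbrakk> \<Longrightarrow> P (B + C)"
  shows "P A"
proof -
  define R where "R S = mat n n (\<lambda>p. if p \<in> S then A $$ p else 0)" for S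
  have "P (R S)" if "finite S" "S \<subseteq> {..<n} \<times> {..<n}" for S
    using that
  proof (induction S rule: finite_induct)
    case empty
    have "R {} = 0\<^sub>m n n" by (rule eq_matI) (auto simp: R_def)
    with zero show ?case by simp
  next
    case (insert p S)
    obtain i j where p: "p = (i, j)" by force
    have "R (insert p S) = unit_mat n i j (A $$ (i, j)) + R S"
      by (rule eq_matI) (use insert p in \<open>auto simp: R_def unit_mat_def\<close>)
    moreover have "R S \<in> carrier_mat n n" by (simp add: R_def)
    ultimately show ?case using insert p by (auto intro!: add unit)
  qed
  from this[of "{..<n} \<times> {..<n}"] have "P (R ({..<n} \<times> {..<n}))" by simp
  moreover have "R ({..<n} \<times> {..<n}) = A"
    by (rule eq_matI) (use A in \<open>auto simp: R_def\<close>)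
  ultimately show ?thesis by simp
qed

section \<open>Bimodules over a matrix ring\<close>

text \<open>
  The right action binds more tightly than the left one here, so that \<open>a \<triangleright> x \<triangleleft> b\<close> has a
  unique reading. The simplifier moves every expression into this form, with the matrices on
  each side collected into one product, on which the multiplication rules of matrix units act.
\<close>

locale matrix_bimodule = unital_bimodule "mat_ring n" lact ract
  for n :: nat
    and lact :: "'r :: {ring, monoid_mult} mat \<Rightarrow> 'm :: ab_group_add \<Rightarrow> 'm" (infixr \<open>\<triangleright>\<close> 75)
    and ract :: "'m \<Rightarrow> 'r mat \<Rightarrow> 'm" (infixl \<open>\<triangleleft>\<close> 76)
begin

abbreviation U :: "nat \<Rightarrow> nat \<Rightarrow> 'r \<Rightarrow> 'r mat" where "U \<equiv> unit_mat n"

abbreviation e :: "nat \<Rightarrow> 'r mat" where "e i \<equiv> U i i 1"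

lemmas mat_distrib = square_mat_distrib[where n = n]
lemmas mat_mult_closed [simp] = mult_carrier_mat[where nr = n and n = n and nc = n]
lemmas lact_add = lact_add_right[simplified] lact_add_left[simplified]
lemmas ract_add = ract_add_left[simplified] ract_add_right[simplified]
lemmas lact_lact [simp] = lact_mult[simplified, symmetric]
lemmas ract_ract [simp] = ract_mult[simplified, symmetric]
lemmas lact_ract_assoc [simp] = lact_ract[simplified]
lemmas act_one [simp] = lact_one[simplified] ract_one[simplified]

lemma lact_zero_right [simp]: "a \<in> carrier_mat n n \<Longrightarrow> a \<triangleright> 0 = 0"
  using lact_add(1)[of a 0 0] by simp

lemma ract_zero_left [simp]: "a \<in> carrier_mat n n \<Longrightarrow> 0 \<triangleleft> a = 0"
  using ract_add(1)[of a 0 0] by simp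

lemma lact_zero_left [simp]: "0\<^sub>m n n \<triangleright> x = 0"
  using lact_add(2)[of "0\<^sub>m n n" "0\<^sub>m n n" x] by simp

lemma ract_zero_right [simp]: "x \<triangleleft> 0\<^sub>m n n = 0"
  using ract_add(2)[of "0\<^sub>m n n" "0\<^sub>m n n" x] by simp

lemma lact_minus_right: "a \<in> carrier_mat n n \<Longrightarrow> a \<triangleright> (- x) = - (a \<triangleright> x)"
  using lact_add(1)[of a x "- x"] by (simp add: eq_neg_iff_add_eq_0 add.commute)

lemma ract_minus_left: "a \<in> carrier_mat n n \<Longrightarrow> (- x) \<triangleleft> a = - (x \<triangleleft> a)"
  using ract_add(1)[of a x "- x"] by (simp add: eq_neg_iff_add_eq_0 add.commute)

lemma lact_unit_minus: "U i j (- r) \<triangleright> x = - (U i j r \<triangleright> x)"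
  using lact_add(2)[of "U i j r" "U i j (- r)" x]
  by (simp add: eq_neg_iff_add_eq_0 add.commute flip: unit_mat_add)

lemma ract_unit_minus: "x \<triangleleft> U i j (- r) = - (x \<triangleleft> U i j r)"
  using ract_add(2)[of "U i j r" "U i j (- r)" x]
  by (simp add: eq_neg_iff_add_eq_0 add.commute flip: unit_mat_add)

lemma lact_diff: "a \<in> carrier_mat n n \<Longrightarrow> a \<triangleright> (x - y) = a \<triangleright> x - a \<triangleright> y"
  using lact_add(1)[of a x "- y"] by (simp add: lact_minus_right)

lemma ract_diff: "a \<in> carrier_mat n n \<Longrightarrow> (x - y) \<triangleleft> a = x \<triangleleft> a - y \<triangleleft> a"
  using ract_add(1)[of a x "- y"] by (simp add: ract_minus_left)

lemma lact_sum: "a \<in> carrier_mat n n \<Longrightarrow> a \<triangleright> sum f S = (\<Sum>i\<in>S. a \<triangleright> f i)"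
  by (induction S rule: infinite_finite_induct) (auto simp: lact_add)

lemma ract_sum: "a \<in> carrier_mat n n \<Longrightarrow> sum f S \<triangleleft> a = (\<Sum>i\<in>S. f i \<triangleleft> a)"
  by (induction S rule: infinite_finite_induct) (auto simp: ract_add)

lemma sum_lact_e: "(\<Sum>i<n. e i \<triangleright> x) = x"
  and sum_ract_e: "(\<Sum>i<n. x \<triangleleft> e i) = x"
proof -
  \<comment> \<open>\<open>p k\<close> is the partial sum \<open>e 0 + \<dots> + e (k - 1)\<close>.\<close>
  define p where "p k = mat n n (\<lambda>(i, j). if i = j \<and> i < k then 1 else 0 :: 'r)" for k
  have p: "p k \<in> carrier_mat n n" for k by (simp add: p_def)
  have step: "p (Suc k) = p k + e k" for k
    by (rule eq_matI) (auto simp: p_def unit_mat_def)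
  have p0: "p 0 = 0\<^sub>m n n" by (rule eq_matI) (auto simp: p_def)
  have pn: "p n = 1\<^sub>m n" by (rule eq_matI) (auto simp: p_def)
  have "(\<Sum>i<k. e i \<triangleright> x) = p k \<triangleright> x" for k
    by (induction k) (simp_all add: step p p0 lact_add)
  from this[of n] show "(\<Sum>i<n. e i \<triangleright> x) = x" by (simp add: pn)
  have "(\<Sum>i<k. x \<triangleleft> e i) = x \<triangleleft> p k" for k
    by (induction k) (simp_all add: step p p0 ract_add)
  from this[of n] show "(\<Sum>i<n. x \<triangleleft> e i) = x" by (simp add: pn)
qed

text \<open>
  Since the \<open>e k\<close> add up to the identity, elements of the bimodule can be compared one Peirce
  row, or one Peirce column, at a time.
\<close>

lemma eq_if_lact_e_eq:
  assumes "\<And>k. k < n \<Longrightarrow> e k \<triangleright> x = e k \<triangleright> y"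
  shows "x = y"
proof -
  have "(\<Sum>k<n. e k \<triangleright> x) = (\<Sum>k<n. e k \<triangleright> y)" using assms by (intro sum.cong) auto
  then show ?thesis by (simp only: sum_lact_e)
qed

lemma eq_if_ract_e_eq:
  assumes "\<And>k. k < n \<Longrightarrow> x \<triangleleft> e k = y \<triangleleft> e k"
  shows "x = y"
proof -
  have "(\<Sum>k<n. x \<triangleleft> e k) = (\<Sum>k<n. y \<triangleleft> e k)" using assms by (intro sum.cong) auto
  then show ?thesis by (simp only: sum_ract_e)
qed

lemma derivation_add:
  assumes "derivation (mat_ring n) lact ract f" "derivation (mat_ring n) lact ract g"
  shows "derivation (mat_ring n) lact ract (\<lambda>a. f a + g a)"
  using assms by (simp add: derivation_def additive_map_def lact_add ract_add algebra_simps)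

lemma derivation_inner: "derivation (mat_ring n) lact ract (\<lambda>a. m \<triangleleft> a - a \<triangleright> m)"
  unfolding derivation_def additive_map_def
proof (intro conjI ballI)
  fix a b :: "'r mat"
  assume ab: "a \<in> carrier (mat_ring n)" "b \<in> carrier (mat_ring n)"
  then show "m \<triangleleft> (a \<oplus>\<^bsub>mat_ring n\<^esub> b) - (a \<oplus>\<^bsub>mat_ring n\<^esub> b) \<triangleright> m = m \<triangleleft> a - a \<triangleright> m + (m \<triangleleft> b - b \<triangleright> m)"
    by (simp add: lact_add ract_add)
  from ab show "m \<triangleleft> (a \<otimes>\<^bsub>mat_ring n\<^esub> b) - (a \<otimes>\<^bsub>mat_ring n\<^esub> b) \<triangleright> m =
      (m \<triangleleft> a - a \<triangleright> m) \<triangleleft> b + a \<triangleright> (m \<triangleleft> b - b \<triangleright> m)"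
    by (simp add: lact_diff ract_diff)
qed

end

section \<open>Maps behaving like Jordan derivations at mutual zero products\<close>

locale zero_product_map = matrix_bimodule n lact ract
  for n :: nat
    and lact :: "'r :: {ring, monoid_mult} mat \<Rightarrow> 'm :: ab_group_add \<Rightarrow> 'm" (infixr \<open>\<triangleright>\<close> 75)
    and ract :: "'m \<Rightarrow> 'r mat \<Rightarrow> 'm" (infixl \<open>\<triangleleft>\<close> 76) +
  fixes D :: "'r mat \<Rightarrow> 'm"
  assumes torsion: "two_torsion_free TYPE('m)"
    and additive: "additive_map (mat_ring n) D"
    and zero_product:
      "\<lbrakk>a \<in> carrier_mat n n; b \<in> carrier_mat n n; a * b = 0\<^sub>m n n; b * a = 0\<^sub>m n n\<rbrakk>
        \<Longrightarrow> D a \<triangleleft> b + a \<triangleright> D b + D b \<triangleleft> a + b \<triangleright> D a = 0"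
begin

lemma double_eq_zeroD: "x + x = 0 \<Longrightarrow> x = 0" for x :: 'm
  using torsion unfolding two_torsion_free_def by blast

lemma double_eqD:
  fixes x y :: 'm
  assumes "x + x = y + y"
  shows "x = y"
proof -
  have "(x - y) + (x - y) = (x + x) - (y + y)" by (simp only: add_diff_add)
  then show ?thesis using double_eq_zeroD[of "x - y"] assms by simp
qed

lemma D_add: "\<lbrakk>a \<in> carrier_mat n n; b \<in> carrier_mat n n\<rbrakk> \<Longrightarrow> D (a + b) = D a + D b"
  using additive by (auto simp: additive_map_def)

lemma D_zero [simp]: "D (0\<^sub>m n n) = 0"
  using D_add[of "0\<^sub>m n n" "0\<^sub>m n n"] by simp

lemma D_unit_minus: "D (U i j (- x)) = - D (U i j x)"
  using D_add[of "U i j x" "U i j (- x)"] by (simp add: eq_neg_iff_add_eq_0 add.commute flip: unit_mat_add)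

lemma idempotent_complement:
  fixes g :: "'r mat"
  assumes g: "g \<in> carrier_mat n n" "g * g = g"
  obtains h where "h \<in> carrier_mat n n" "g + h = 1\<^sub>m n" "g * h = 0\<^sub>m n n" "h * g = 0\<^sub>m n n" "h * h = h"
proof -
  let ?h = "1\<^sub>m n - g"
  have h: "?h \<in> carrier_mat n n" using g by (intro minus_carrier_mat)
  have s: "g + ?h = 1\<^sub>m n" by (rule eq_matI) (use g in auto)
  have gh: "g * ?h = 0\<^sub>m n n"
    using g by (simp add: mat_distrib right_mult_one_mat_ring)
  have hg: "?h * g = 0\<^sub>m n n"
    using g by (simp add: mat_distrib left_mult_one_mat_ring)
  have "?h - 0\<^sub>m n n = ?h" by (rule eq_matI) (use g in auto)
  then have "?h * ?h = ?h"
    using g h gh mat_distrib(3)[of "1\<^sub>m n" g ?h]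
    by (simp add: left_mult_one_mat_ring)
  with h s gh hg show thesis by (rule that)
qed

text \<open>
  In \<open>g D(1) h\<close>, with \<open>h\<close> the complement of \<open>g\<close>, the value \<open>D 1 = D g + D h\<close> contributes just the two
  terms that survive when the identity for the pair \<open>(g, h)\<close> is cut by \<open>g\<close> on the left and \<open>h\<close>
  on the right. Hence \<open>g D(1) h = 0\<close>, and symmetrically \<open>h D(1) g = 0\<close>.
\<close>

lemma D_one_commutes_idempotent:
  assumes g: "g \<in> carrier_mat n n" "g * g = g"
  shows "g \<triangleright> D (1\<^sub>m n) = D (1\<^sub>m n) \<triangleleft> g"
proof -
  obtain h where h: "h \<in> carrier_mat n n" "g + h = 1\<^sub>m n" "g * h = 0\<^sub>m n n" "h * g = 0\<^sub>m n n" "h * h = h"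
    using idempotent_complement[OF g] .
  have one: "D (1\<^sub>m n) = D g + D h" using D_add[of g h] g h by simp
  have *: "D g \<triangleleft> h + g \<triangleright> D h + D h \<triangleleft> g + h \<triangleright> D g = 0"
    using g h by (intro zero_product)
  have "g \<triangleright> (D g \<triangleleft> h + g \<triangleright> D h + D h \<triangleleft> g + h \<triangleright> D g) \<triangleleft> h = 0"
    using g h by (simp add: *)
  then have gh: "g \<triangleright> D (1\<^sub>m n) \<triangleleft> h = 0"
    using g h by (simp add: one lact_add ract_add)
  have "h \<triangleright> (D g \<triangleleft> h + g \<triangleright> D h + D h \<triangleleft> g + h \<triangleright> D g) \<triangleleft> g = 0"
    using g h by (simp add: *)
  then have hg: "h \<triangleright> D (1\<^sub>m n) \<triangleleft> g = 0"
    using g h by (simp add: one lact_add ract_add add.commute)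
  have "g \<triangleright> D (1\<^sub>m n) = g \<triangleright> D (1\<^sub>m n) \<triangleleft> (g + h)" using h by simp
  also have "\<dots> = g \<triangleright> (D (1\<^sub>m n) \<triangleleft> g + D (1\<^sub>m n) \<triangleleft> h)"
    by (subst ract_add(2)) (use g h in auto)
  also have "\<dots> = g \<triangleright> D (1\<^sub>m n) \<triangleleft> g" using g gh by (simp add: lact_add)
  also have "\<dots> = (g + h) \<triangleright> D (1\<^sub>m n) \<triangleleft> g"
    by (subst lact_add(2)) (use g h hg in auto)
  also have "\<dots> = D (1\<^sub>m n) \<triangleleft> g" using h by simp
  finally show ?thesis .
qed

text \<open>
  The idempotents generate the matrix ring: off the diagonal, \<open>U k l y\<close> is the difference of the
  idempotents \<open>e k + U k l y\<close> and \<open>e k\<close>, and a matrix unit on the diagonal is a product of two off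
  the diagonal.
\<close>

lemma D_one_commutes:
  assumes n: "n \<ge> 2" and a: "a \<in> carrier_mat n n"
  shows "a \<triangleright> D (1\<^sub>m n) = D (1\<^sub>m n) \<triangleleft> a"
  using a
proof (induction a rule: unit_mat_induct)
  case (unit i j x)
  let ?c = "D (1\<^sub>m n)"
  have offdiag: "U k l y \<triangleright> ?c = ?c \<triangleleft> U k l y" if "k < n" "l < n" "k \<noteq> l" for k l y
  proof -
    have "(e k + U k l y) \<triangleright> ?c = ?c \<triangleleft> (e k + U k l y)"
      using that by (intro D_one_commutes_idempotent)
        (auto simp: mat_distrib)
    moreover have "e k \<triangleright> ?c = ?c \<triangleleft> e k"
      using that by (intro D_one_commutes_idempotent) auto
    ultimately show ?thesis by (simp add: lact_add ract_add)
  qed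
  show ?case
  proof (cases "i = j")
    case True
    obtain k where k: "k < n" "k \<noteq> i"
      using n by (metis One_nat_def less_2_cases_iff less_le_trans zero_neq_one)
    have U: "U i i x = U i k x * U k i 1" using k by simp
    have "(U i k x * U k i 1) \<triangleright> ?c = U i k x \<triangleright> (U k i 1 \<triangleright> ?c)"
      by (rule lact_mult[simplified]) auto
    also have "\<dots> = U i k x \<triangleright> ?c \<triangleleft> U k i 1" using offdiag[of k i 1] k unit by simp
    also have "\<dots> = (U i k x \<triangleright> ?c) \<triangleleft> U k i 1" by simp
    also have "\<dots> = ?c \<triangleleft> U i k x \<triangleleft> U k i 1" using offdiag[of i k x] k unit by simp
    also have "\<dots> = ?c \<triangleleft> (U i k x * U k i 1)" by simp
    finally show ?thesis using U True by simp
  qed (use unit offdiag in auto)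
qed (simp_all add: lact_add ract_add)

text \<open>
  Two modifications of \<open>D\<close> keep the hypothesis, and together they reduce the problem to maps that
  vanish on the identity and on the diagonal idempotents. At a mutual zero product a derivation contributes
  its values at \<open>a b\<close> and \<open>b a\<close>, and \<open>a \<mapsto> a D(1)\<close> contributes multiples of \<open>a b\<close> and \<open>b a\<close>.
\<close>

lemma zero_product_map_diff_derivation:
  assumes "derivation (mat_ring n) lact ract d"
  shows "zero_product_map n lact ract (\<lambda>a. D a - d a)"
proof unfold_locales
  show "additive_map (mat_ring n) (\<lambda>a. D a - d a)"
    using assms by (auto simp: derivation_def additive_map_def D_add)
next
  fix a b :: "'r mat"
  assume ab: "a \<in> carrier_mat n n" "b \<in> carrier_mat n n" "a * b = 0\<^sub>m n n" "b * a = 0\<^sub>m n n"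
  have d0: "d (0\<^sub>m n n) = 0"
    using assms unfolding derivation_def additive_map_def
    by (metis add_cancel_right_right left_add_zero_mat mat_ring_simps(1,5) zero_carrier_mat)
  have "d (a * b) = d a \<triangleleft> b + a \<triangleright> d b" "d (b * a) = d b \<triangleleft> a + b \<triangleright> d a"
    using assms ab(1,2) by (simp_all add: derivation_def)
  then have d_zero: "d a \<triangleleft> b + a \<triangleright> d b = 0" "d b \<triangleleft> a + b \<triangleright> d a = 0"
    using ab d0 by simp_all
  have total: "(D a - d a) \<triangleleft> b + a \<triangleright> (D b - d b) + (D b - d b) \<triangleleft> a + b \<triangleright> (D a - d a) =
      (D a \<triangleleft> b + a \<triangleright> D b + D b \<triangleleft> a + b \<triangleright> D a) - (d a \<triangleleft> b + a \<triangleright> d b) - (d b \<triangleleft> a + b \<triangleright> d a)"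
    using ab by (simp add: lact_diff ract_diff algebra_simps)
  show "(D a - d a) \<triangleleft> b + a \<triangleright> (D b - d b) + (D b - d b) \<triangleleft> a + b \<triangleright> (D a - d a) = 0"
    unfolding total d_zero zero_product[OF ab] by simp
qed (rule torsion)

lemma zero_product_map_diff_one:
  assumes n: "n \<ge> 2"
  shows "zero_product_map n lact ract (\<lambda>a. D a - a \<triangleright> D (1\<^sub>m n))"
proof unfold_locales
  show "additive_map (mat_ring n) (\<lambda>a. D a - a \<triangleright> D (1\<^sub>m n))"
    by (auto simp: additive_map_def D_add lact_add)
next
  fix a b :: "'r mat"
  let ?c = "D (1\<^sub>m n)"
  assume ab: "a \<in> carrier_mat n n" "b \<in> carrier_mat n n" "a * b = 0\<^sub>m n n" "b * a = 0\<^sub>m n n"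
  have "a \<triangleright> ?c \<triangleleft> b = 0" "b \<triangleright> ?c \<triangleleft> a = 0"
    using ab by (simp_all add: D_one_commutes[OF n, symmetric])
  then show "(D a - a \<triangleright> ?c) \<triangleleft> b + a \<triangleright> (D b - b \<triangleright> ?c) + (D b - b \<triangleright> ?c) \<triangleleft> a + b \<triangleright> (D a - a \<triangleright> ?c) = 0"
    using zero_product[OF ab] ab by (simp add: lact_diff ract_diff)
qed (rule torsion)

text \<open>
  If \<open>D 1 = 0\<close>, the complement \<open>h\<close> of \<open>g\<close> has \<open>D h = - D g\<close>, and the identity for \<open>(g, h)\<close> says that
  \<open>D(g) h + h D(g)\<close> equals \<open>D(g) g + g D(g)\<close>. Their sum is \<open>2 D(g)\<close>, because \<open>g + h = 1\<close>, and \<open>2\<close> can be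
  cancelled.
\<close>

lemma D_idempotent:
  assumes D1: "D (1\<^sub>m n) = 0" and g: "g \<in> carrier_mat n n" "g * g = g"
  shows "D g = D g \<triangleleft> g + g \<triangleright> D g"
proof -
  obtain h where h: "h \<in> carrier_mat n n" "g + h = 1\<^sub>m n" "g * h = 0\<^sub>m n n" "h * g = 0\<^sub>m n n"
    using idempotent_complement[OF g] by metis
  have Dh: "D h = - D g" using D_add[of g h] g h D1 by (simp add: eq_neg_iff_add_eq_0 add.commute)
  have "D g \<triangleleft> h + g \<triangleright> D h + D h \<triangleleft> g + h \<triangleright> D g = 0"
    using g h by (intro zero_product)
  then have *: "D g \<triangleleft> h + h \<triangleright> D g = D g \<triangleleft> g + g \<triangleright> D g"
    using g by (simp add: Dh lact_minus_right ract_minus_left algebra_simps)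
  have "D g = D g \<triangleleft> g + D g \<triangleleft> h" "D g = g \<triangleright> D g + h \<triangleright> D g"
    using ract_add(2)[of g h "D g"] lact_add(2)[of g h "D g"] g h by simp_all
  then have "D g + D g = (D g \<triangleleft> g + g \<triangleright> D g) + (D g \<triangleleft> h + h \<triangleright> D g)"
    by (metis add.assoc add.commute)
  then show ?thesis unfolding * by (rule double_eqD)
qed

text \<open>
  If \<open>D\<close> were the inner derivation of some \<open>m\<close>, normalized to have no diagonal Peirce components,
  then \<open>D(e\<^sub>i) e\<^sub>i = m e\<^sub>i\<close>, so \<open>m\<close> would have to be the sum of the \<open>D(e\<^sub>i) e\<^sub>i\<close>. The identity for the
  orthogonal pair \<open>(e\<^sub>i, e\<^sub>j)\<close> is what makes this candidate work.
\<close>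

lemma inner_on_diagonal:
  assumes D1: "D (1\<^sub>m n) = 0"
  obtains m where "\<And>j. j < n \<Longrightarrow> D (e j) = m \<triangleleft> e j - e j \<triangleright> m"
proof
  define m where "m = (\<Sum>i<n. D (e i) \<triangleleft> e i)"
  fix j assume j: "j < n"
  have idem: "D (e j) = D (e j) \<triangleleft> e j + e j \<triangleright> D (e j)"
    using D_idempotent[OF D1, of "e j"] j by simp
  have "m \<triangleleft> e j = (\<Sum>i<n. D (e i) \<triangleleft> e i \<triangleleft> e j)"
    unfolding m_def by (rule ract_sum) simp
  also have "\<dots> = (\<Sum>i<n. if i = j then D (e j) \<triangleleft> e j else 0)"
    by (rule sum.cong) (use j in auto)
  finally have "m \<triangleleft> e j = (\<Sum>i<n. if i = j then D (e j) \<triangleleft> e j else 0)" .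
  then have 1: "m \<triangleleft> e j = D (e j) \<triangleleft> e j" using j by simp
  have "e j \<triangleright> D (e i) \<triangleleft> e i = - (e j \<triangleright> D (e j) \<triangleleft> e i)" if i: "i < n" for i
  proof (cases "i = j")
    case True
    have "e j \<triangleright> D (e j) \<triangleleft> e j = e j \<triangleright> (D (e j) \<triangleleft> e j + e j \<triangleright> D (e j)) \<triangleleft> e j"
      using idem by simp
    then show ?thesis using True j by (simp add: lact_add ract_add)
  next
    case False
    have "D (e i) \<triangleleft> e j + e i \<triangleright> D (e j) + D (e j) \<triangleleft> e i + e j \<triangleright> D (e i) = 0"
      using i j False by (intro zero_product) auto
    then have "e j \<triangleright> (D (e i) \<triangleleft> e j + e i \<triangleright> D (e j) + D (e j) \<triangleleft> e i + e j \<triangleright> D (e i)) \<triangleleft> e i = 0"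
      by simp
    then show ?thesis
      using i j False by (simp add: lact_add ract_add eq_neg_iff_add_eq_0 add.commute)
  qed
  then have "e j \<triangleright> m = (\<Sum>i<n. - ((e j \<triangleright> D (e j)) \<triangleleft> e i))"
    unfolding m_def by (subst lact_sum) (auto intro!: sum.cong)
  also have "\<dots> = - (e j \<triangleright> D (e j))"
    by (simp only: sum_negf sum_ract_e)
  finally show "D (e j) = m \<triangleleft> e j - e j \<triangleright> m" using 1 idem by simp
qed

end

section \<open>Maps vanishing on the diagonal idempotents\<close>

locale diagonal_normalized_map = zero_product_map n lact ract D
  for n :: nat
    and lact :: "'r :: {ring, monoid_mult} mat \<Rightarrow> 'm :: ab_group_add \<Rightarrow> 'm" (infixr \<open>\<triangleright>\<close> 75)
    and ract :: "'m \<Rightarrow> 'r mat \<Rightarrow> 'm" (infixl \<open>\<triangleleft>\<close> 76)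
    and D :: "'r mat \<Rightarrow> 'm" +
  assumes D_one [simp]: "D (1\<^sub>m n) = 0"
    and D_e [simp]: "i < n \<Longrightarrow> D (e i) = 0"
begin

text \<open>
  As \<open>D (e k) = 0\<close>, the identity for the pair \<open>(a, e k)\<close> reduces to \<open>D(a) e\<^sub>k + e\<^sub>k D(a) = 0\<close>. Cutting by
  \<open>e\<^sub>k\<close> on both sides kills the corner, by torsion-freeness, and then both summands.
\<close>

lemma D_orthogonal_e:
  assumes a: "a \<in> carrier_mat n n" and k: "k < n" and 0: "e k * a = 0\<^sub>m n n" "a * e k = 0\<^sub>m n n"
  shows "e k \<triangleright> D a = 0" "D a \<triangleleft> e k = 0"
proof -
  have *: "D a \<triangleleft> e k + e k \<triangleright> D a = 0"
    using zero_product[OF a _ 0(2,1)] a k by simp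
  then have "e k \<triangleright> (D a \<triangleleft> e k + e k \<triangleright> D a) \<triangleleft> e k = 0" by simp
  then have "e k \<triangleright> D a \<triangleleft> e k + e k \<triangleright> D a \<triangleleft> e k = 0"
    using k by (simp add: lact_add ract_add)
  then have corner: "e k \<triangleright> D a \<triangleleft> e k = 0" by (rule double_eq_zeroD)
  have "e k \<triangleright> (D a \<triangleleft> e k + e k \<triangleright> D a) = 0" using * by simp
  then show "e k \<triangleright> D a = 0" using k corner by (simp add: lact_add)
  with * show "D a \<triangleleft> e k = 0" by simp
qed

text \<open>
  Products of two elements \<open>x\<^sub>i\<^sub>j\<close>, \<open>y\<^sub>i\<^sub>j\<close> vanish, so \<open>y\<^sub>i\<^sub>j D(z\<^sub>i\<^sub>j) e\<^sub>i\<close> is skew-symmetric in \<open>y\<close> and \<open>z\<close>.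
  At \<open>y = z = 1\<close> this forces the corner of \<open>D(1\<^sub>i\<^sub>j)\<close> to be zero; one argument equal to \<open>1\<close> then
  gives the general case, since \<open>1\<^sub>i\<^sub>j\<close> can be cancelled by \<open>1\<^sub>j\<^sub>i\<close>.
\<close>

lemma lower_corner_zero:
  assumes ij: "i < n" "j < n" "i \<noteq> j"
  shows "e j \<triangleright> D (U i j x) \<triangleleft> e i = 0"
proof -
  have swap: "U i j y \<triangleright> D (U i j z) \<triangleleft> e i + U i j z \<triangleright> D (U i j y) \<triangleleft> e i = 0" for y z
  proof -
    have "D (U i j y) \<triangleleft> U i j z + U i j y \<triangleright> D (U i j z)
        + D (U i j z) \<triangleleft> U i j y + U i j z \<triangleright> D (U i j y) = 0"
      using ij by (intro zero_product) auto
    then have "(D (U i j y) \<triangleleft> U i j z + U i j y \<triangleright> D (U i j z)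
        + D (U i j z) \<triangleleft> U i j y + U i j z \<triangleright> D (U i j y)) \<triangleleft> e i = 0"
      by simp
    then show ?thesis using ij by (simp add: ract_add)
  qed
  have cancel: "e j \<triangleright> y = 0" if "U i j 1 \<triangleright> y = 0" for y
  proof -
    have "U j i 1 \<triangleright> U i j 1 \<triangleright> y = 0" using that by (simp del: lact_lact)
    then show ?thesis using ij by simp
  qed
  have "U i j 1 \<triangleright> D (U i j 1) \<triangleleft> e i = 0" using swap[of 1 1] by (rule double_eq_zeroD)
  then have "e j \<triangleright> D (U i j 1) \<triangleleft> e i = 0" by (rule cancel)
  then have "U i j x \<triangleright> e j \<triangleright> D (U i j 1) \<triangleleft> e i = 0" by (simp del: lact_lact)
  then have "U i j x \<triangleright> D (U i j 1) \<triangleleft> e i = 0" using ij by simp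
  then have "U i j 1 \<triangleright> D (U i j x) \<triangleleft> e i = 0" using swap[of x 1] by simp
  then show ?thesis by (rule cancel)
qed

text \<open>
  Rows and columns of \<open>D(x\<^sub>i\<^sub>j)\<close> with other indices are zero by orthogonality. On the diagonal that
  is all; off it, the idempotent \<open>e\<^sub>i + x\<^sub>i\<^sub>j\<close> shows that exactly one of the two outer indices is
  \<open>i\<close>, and the absence of a lower corner decides which.
\<close>

lemma D_unit_peirce:
  assumes ij: "i < n" "j < n"
  shows "e i \<triangleright> D (U i j x) = D (U i j x)" "D (U i j x) \<triangleleft> e j = D (U i j x)"
proof -
  let ?d = "D (U i j x)"
  have other: "e k \<triangleright> ?d = 0" "?d \<triangleleft> e k = 0" if "k < n" "k \<noteq> i" "k \<noteq> j" for k
    using D_orthogonal_e[of "U i j x" k] that ij by auto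
  have "e i \<triangleright> ?d = ?d \<and> ?d \<triangleleft> e j = ?d"
  proof (cases "i = j")
    case True
    have "e i \<triangleright> ?d = ?d"
    proof (rule eq_if_lact_e_eq)
      fix k assume "k < n"
      then show "e k \<triangleright> e i \<triangleright> ?d = e k \<triangleright> ?d" using other[of k] ij True by (cases "k = i") auto
    qed
    moreover have "?d \<triangleleft> e j = ?d"
    proof (rule eq_if_ract_e_eq)
      fix k assume "k < n"
      then show "?d \<triangleleft> e j \<triangleleft> e k = ?d \<triangleleft> e k" using other[of k] ij True by (cases "k = i") auto
    qed
    ultimately show ?thesis ..
  next
    case False
    have "D (e i + U i j x) = D (e i + U i j x) \<triangleleft> (e i + U i j x) + (e i + U i j x) \<triangleright> D (e i + U i j x)"
      using ij False by (intro D_idempotent)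
        (auto simp: mat_distrib)
    then have 1: "?d = ?d \<triangleleft> e i + e i \<triangleright> ?d + (?d \<triangleleft> U i j x + U i j x \<triangleright> ?d)"
      using ij by (simp add: D_add lact_add ract_add algebra_simps)
    \<comment> \<open>\<open>U i j x\<close> squares to zero, so it may be paired with itself.\<close>
    have "(?d \<triangleleft> U i j x + U i j x \<triangleright> ?d) + (?d \<triangleleft> U i j x + U i j x \<triangleright> ?d) = 0"
      using zero_product[of "U i j x" "U i j x"] ij False by (simp add: add.assoc)
    then have "?d \<triangleleft> U i j x + U i j x \<triangleright> ?d = 0" by (rule double_eq_zeroD)
    with 1 have split: "?d = ?d \<triangleleft> e i + e i \<triangleright> ?d" by simp
    have "e j \<triangleright> ?d = e j \<triangleright> (?d \<triangleleft> e i + e i \<triangleright> ?d)" using split by simp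
    also have "\<dots> = 0" using lower_corner_zero ij False by (simp add: lact_add)
    finally have ej: "e j \<triangleright> ?d = 0" .
    have left: "e i \<triangleright> ?d = ?d"
    proof (rule eq_if_lact_e_eq)
      fix k assume "k < n"
      then show "e k \<triangleright> e i \<triangleright> ?d = e k \<triangleright> ?d"
        using other[of k] ej ij by (cases "k = i"; cases "k = j") auto
    qed
    with split have ei: "?d \<triangleleft> e i = 0" by simp
    have "?d \<triangleleft> e j = ?d"
    proof (rule eq_if_ract_e_eq)
      fix k assume "k < n"
      then show "?d \<triangleleft> e j \<triangleleft> e k = ?d \<triangleleft> e k"
        using other[of k] ei ij by (cases "k = i"; cases "k = j") auto
    qed
    with left show ?thesis by simp
  qed
  then show "e i \<triangleright> ?d = ?d" "?d \<triangleleft> e j = ?d" by auto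
qed

lemma lact_D_unit_diff [simp]:
  assumes "i < n" "j < n" "l < n" "l \<noteq> i"
  shows "U k l y \<triangleright> D (U i j x) = 0"
proof -
  have "U k l y \<triangleright> D (U i j x) = U k l y \<triangleright> e i \<triangleright> D (U i j x)"
    using D_unit_peirce(1)[of i j x] assms by (simp del: lact_lact)
  then show ?thesis using assms by simp
qed

lemma ract_D_unit_diff [simp]:
  assumes "i < n" "j < n" "k < n" "k \<noteq> j"
  shows "D (U i j x) \<triangleleft> U k l y = 0"
proof -
  have "D (U i j x) \<triangleleft> U k l y = D (U i j x) \<triangleleft> e j \<triangleleft> U k l y"
    using D_unit_peirce(2)[of i j x] assms by (simp del: ract_ract)
  then show ?thesis using assms by simp
qed

lemma lact_D_unit_ract [simp]:
  assumes "i < n" "j < n" "k < n" "a \<in> carrier_mat n n"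
  shows "e k \<triangleright> D (U i j x) \<triangleleft> a = (if k = i then D (U i j x) \<triangleleft> a else 0)"
proof -
  have "e k \<triangleright> D (U i j x) \<triangleleft> a = (e k \<triangleright> D (U i j x)) \<triangleleft> a"
    using assms by simp
  then show ?thesis using assms by (simp add: D_unit_peirce del: lact_ract_assoc)
qed

lemmas expand = D_add D_unit_minus lact_add ract_add lact_minus_right ract_minus_left
  lact_diff ract_diff lact_unit_minus ract_unit_minus mat_distrib

text \<open>
  The pair is chosen so that \<open>a b\<close> contains \<open>x\<^sub>i\<^sub>j y\<^sub>j\<^sub>k - (x y)\<^sub>i\<^sub>k e\<^sub>k\<close>, which cancels, while \<open>b a = 0\<close> for lack of
  matching indices. By the Peirce grading the terms \<open>D(b) a\<close> and \<open>b D(a)\<close> are zero too, and the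
  others are the product rule, as \<open>D (e k) = 0\<close>.
\<close>

lemma product_rule_last_index_apart:
  assumes "i < n" "j < n" "k < n" "k \<noteq> i" "k \<noteq> j"
  shows "D (U i k (x * y)) = D (U i j x) \<triangleleft> U j k y + U i j x \<triangleright> D (U j k y)"
proof -
  let ?a = "U i j x + U i k (- (x * y))" and ?b = "U j k y + e k"
  have "?a * ?b = U i k (x * y) + U i k (- (x * y))"
    using assms by (simp add: expand)
  then have "?a * ?b = 0\<^sub>m n n" by (simp flip: unit_mat_add)
  moreover have "?b * ?a = 0\<^sub>m n n" using assms by (simp add: expand)
  ultimately have "D ?a \<triangleleft> ?b + ?a \<triangleright> D ?b + D ?b \<triangleleft> ?a + ?b \<triangleright> D ?a = 0"
    by (intro zero_product) auto
  then show ?thesis using assms by (simp add: expand D_unit_peirce algebra_simps)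
qed

text \<open>The mirror image: the correction term is attached to \<open>y\<^sub>j\<^sub>k\<close> and absorbed by \<open>e\<^sub>i\<close>.\<close>

lemma product_rule_first_index_apart:
  assumes "i < n" "j < n" "k < n" "i \<noteq> j" "i \<noteq> k"
  shows "D (U i k (x * y)) = D (U i j x) \<triangleleft> U j k y + U i j x \<triangleright> D (U j k y)"
proof -
  let ?a = "U i j x + e i" and ?b = "U j k y + U i k (- (x * y))"
  have "?a * ?b = U i k (x * y) + U i k (- (x * y))"
    using assms by (simp add: expand)
  then have "?a * ?b = 0\<^sub>m n n" by (simp flip: unit_mat_add)
  moreover have "?b * ?a = 0\<^sub>m n n" using assms by (simp add: expand)
  ultimately have "D ?a \<triangleleft> ?b + ?a \<triangleright> D ?b + D ?b \<triangleleft> ?a + ?b \<triangleright> D ?a = 0"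
    by (intro zero_product) auto
  then show ?thesis using assms by (simp add: expand D_unit_peirce algebra_simps)
qed

text \<open>
  In the \<open>2 \<times> 2\<close> block of the indices \<open>i\<close> and \<open>j\<close>, let \<open>a\<close> be the column \<open>(1, y)\<close> times the row \<open>(1, x)\<close>, and
  \<open>b\<close> the column \<open>(-x, 1)\<close> times the row \<open>(-y, 1)\<close>. Each row is orthogonal to the column of the other
  matrix, so \<open>a b = b a = 0\<close>. The component of the identity at \<open>(i, i)\<close> is twice the product rule.
\<close>

lemma product_rule_loop:
  assumes "i < n" "j < n" "i \<noteq> j"
  shows "D (U i i (x * y)) = D (U i j x) \<triangleleft> U j i y + U i j x \<triangleright> D (U j i y)"
proof -
  let ?a = "e i + U i j x + U j i y + U j j (y * x)"
  let ?b = "U i i (x * y) + U i j (- x) + U j i (- y) + e j"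
  have "?a * ?b = 0\<^sub>m n n"
    using assms by (simp add: expand) (rule eq_matI; auto simp: unit_mat_def mult.assoc)
  moreover have "?b * ?a = 0\<^sub>m n n"
    using assms by (simp add: expand) (rule eq_matI; auto simp: unit_mat_def mult.assoc)
  ultimately have *: "D ?a \<triangleleft> ?b + ?a \<triangleright> D ?b + D ?b \<triangleleft> ?a + ?b \<triangleright> D ?a = 0"
    by (intro zero_product) auto
  then have "e i \<triangleright> (D ?a \<triangleleft> ?b + ?a \<triangleright> D ?b + D ?b \<triangleleft> ?a + ?b \<triangleright> D ?a) \<triangleleft> e i = 0"
    by simp
  then have "D (U i i (x * y)) + D (U i i (x * y)) =
      (D (U i j x) \<triangleleft> U j i y + U i j x \<triangleright> D (U j i y)) +
      (D (U i j x) \<triangleleft> U j i y + U i j x \<triangleright> D (U j i y))"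
    using assms by (simp add: expand D_unit_peirce algebra_simps)
  then show ?thesis by (rule double_eqD)
qed

lemma derivation_D:
  assumes n: "n \<ge> 2"
  shows "derivation (mat_ring n) lact ract D"
proof -
  have units: "D (U i j x * U k l y) = D (U i j x) \<triangleleft> U k l y + U i j x \<triangleright> D (U k l y)"
    if ijkl: "i < n" "j < n" "k < n" "l < n" for i j k l x y
  proof (cases "j = k")
    case False
    then show ?thesis using ijkl by simp
  next
    case jk: True
    consider "l \<noteq> i" "l \<noteq> j" | "i \<noteq> j" "i \<noteq> l" | "i \<noteq> j" "l = i" | "i = j" "l = i"
      by metis
    then show ?thesis
    proof cases
      case 1
      then show ?thesis using product_rule_last_index_apart[of i j l x y] ijkl jk by simp
    next
      case 2
      then show ?thesis using product_rule_first_index_apart[of i j l x y] ijkl jk by simp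
    next
      case 3
      then show ?thesis using product_rule_loop[of i j x y] ijkl jk by simp
    next
      case 4
      obtain m where m: "m < n" "m \<noteq> i"
        using n by (metis One_nat_def less_2_cases_iff less_le_trans zero_neq_one)
      \<comment> \<open>Expanding \<open>D\<close> of \<open>x\<^sub>i\<^sub>i y\<^sub>i\<^sub>i 1\<^sub>i\<^sub>m\<close> with either bracketing shows that the defect of the
         product rule, multiplied by \<open>1\<^sub>i\<^sub>m\<close>, is zero; multiplying by \<open>1\<^sub>m\<^sub>i\<close> recovers the defect.\<close>
      have rule: "D (U i m (a * b)) = D (U i i a) \<triangleleft> U i m b + U i i a \<triangleright> D (U i m b)" for a b
        using product_rule_last_index_apart[of i i m a b] m ijkl by simp
      have "D (U i i (x * y)) \<triangleleft> U i m 1 + U i i (x * y) \<triangleright> D (U i m 1) = D (U i m (x * y))"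
        using rule[of "x * y" 1] by simp
      also have "\<dots> = D (U i i x) \<triangleleft> U i m y + U i i x \<triangleright> D (U i m y)"
        by (rule rule)
      also have "D (U i m y) = D (U i i y) \<triangleleft> U i m 1 + U i i y \<triangleright> D (U i m 1)"
        using rule[of y 1] by simp
      finally have "D (U i i (x * y)) \<triangleleft> U i m 1 = (D (U i i x) \<triangleleft> U i i y + U i i x \<triangleright> D (U i i y)) \<triangleleft> U i m 1"
        using ijkl by (simp add: lact_add ract_add)
      then have "D (U i i (x * y)) \<triangleleft> U i m 1 \<triangleleft> U m i 1
          = (D (U i i x) \<triangleleft> U i i y + U i i x \<triangleright> D (U i i y)) \<triangleleft> U i m 1 \<triangleleft> U m i 1"
        by (simp only:)
      then show ?thesis using 4 jk ijkl m by (simp add: ract_add D_unit_peirce)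
    qed
  qed
  have unit_left: "D (U i j x * b) = D (U i j x) \<triangleleft> b + U i j x \<triangleright> D b"
    if "i < n" "j < n" and b: "b \<in> carrier_mat n n" for i j x b
    using b
  proof (induction b rule: unit_mat_induct)
    case (unit k l y)
    then show ?case using units that(1,2) by simp
  qed (use that in \<open>simp_all add: expand algebra_simps\<close>)
  have "D (a * b) = D a \<triangleleft> b + a \<triangleright> D b" if a: "a \<in> carrier_mat n n" and b: "b \<in> carrier_mat n n" for a b
    using a
  proof (induction a rule: unit_mat_induct)
    case (unit i j x)
    then show ?case using unit_left b by simp
  qed (use b in \<open>simp_all add: expand algebra_simps\<close>)
  then show ?thesis using additive by (simp add: derivation_def)
qed

end

section \<open>The decomposition\<close>

context zero_product_map
begin

lemma derivation_if_D_one_zero: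
  assumes n: "n \<ge> 2" and D1: "D (1\<^sub>m n) = 0"
  shows "derivation (mat_ring n) lact ract D"
proof -
  obtain m where m: "\<And>j. j < n \<Longrightarrow> D (e j) = m \<triangleleft> e j - e j \<triangleright> m"
    using inner_on_diagonal[OF D1] by blast
  let ?D = "\<lambda>a. D a - (m \<triangleleft> a - a \<triangleright> m)"
  interpret N: zero_product_map n lact ract ?D
    by (rule zero_product_map_diff_derivation) (rule derivation_inner)
  interpret N: diagonal_normalized_map n lact ract ?D
    by unfold_locales (simp_all add: D1 m)
  show ?thesis
    using derivation_add[OF N.derivation_D[OF n] derivation_inner[of m]] by simp
qed

end

theorem theorem2p1:
  fixes n :: nat
    and lact :: "'r :: {ring, monoid_mult} mat \<Rightarrow> 'm :: ab_group_add \<Rightarrow> 'm" (infixr \<open>\<triangleright>\<close> 75)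
    and ract :: "'m \<Rightarrow> 'r mat \<Rightarrow> 'm" (infixl \<open>\<triangleleft>\<close> 75)
    and D :: "'r mat \<Rightarrow> 'm"
  assumes "n \<ge> 2"
    and "unital_bimodule (mat_ring n) lact ract"
    and "two_torsion_free TYPE('m)"
    and "additive_map (mat_ring n) D"
    and "\<And>a b. \<lbrakk>a \<in> carrier_mat n n; b \<in> carrier_mat n n; a * b = 0\<^sub>m n n; b * a = 0\<^sub>m n n\<rbrakk>
      \<Longrightarrow> D a \<triangleleft> b + a \<triangleright> D b + D b \<triangleleft> a + b \<triangleright> D a = 0"
  shows "(\<exists>\<delta>. derivation (mat_ring n) lact ract \<delta> \<and>
           (\<forall>a\<in>carrier_mat n n. D a = \<delta> a + a \<triangleright> D (1\<^sub>m n))) \<and>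
         D (1\<^sub>m n) \<in> bimodule_centre (mat_ring n) lact ract"
proof -
  interpret unital_bimodule "mat_ring n" lact ract by fact
  interpret zero_product_map n lact ract D
    by unfold_locales (use assms in auto)
  let ?\<delta> = "\<lambda>a. D a - a \<triangleright> D (1\<^sub>m n)"
  interpret \<delta>: zero_product_map n lact ract ?\<delta>
    using assms(1) by (rule zero_product_map_diff_one)
  have "derivation (mat_ring n) lact ract ?\<delta>"
    using assms(1) by (rule \<delta>.derivation_if_D_one_zero) simp
  moreover have "D (1\<^sub>m n) \<in> bimodule_centre (mat_ring n) lact ract"
    using D_one_commutes[OF assms(1)] by (simp add: bimodule_centre_def)
  ultimately show ?thesis by (intro conjI exI[of _ ?\<delta>]) simp_all
qed

end
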